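(* Let $\mathcal{P}$ be a parabola and let $\mathcal{D}$ be a circle centered at the focus of $\mathcal{P}$ whose diameter is bigger than the distance from the focus to the directrix of $\mathcal{P}$. Then there exists a quadrilateral inscribed in $\mathcal{D}$ and circumscribed about $\mathcal{P}$. There are infinitely many such quadrilaterals. Moreover, there are infinitely many parabolas confocal with $\mathcal{P}$ having the same property with respect to the same circle $\mathcal{D}$.
   Context: A quadrilateral $ABCD$ (vertices in this cyclic order, possibly self-intersecting) is inscribed in $\mathcal{D}$ if its vertices lie on $\mathcal{D}$, and circumscribed about $\mathcal{P}$ if the lines $AB,BC,CD,DA$ are tangent to $\mathcal{P}$. Two parabolas are confocal if they have the same focus and the same axis of symmetry. *)

theory Defs
  imports "HOL-Analysis.Analysis"
begin

type_synonym point = "real^2"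

definition is_line :: "point set \<Rightarrow> bool" where
  "is_line m \<longleftrightarrow> affine m \<and> aff_dim m = 1"

definition is_parabola :: "point set \<Rightarrow> point \<Rightarrow> point set \<Rightarrow> bool" where
  "is_parabola P F l \<longleftrightarrow> is_line l \<and> F \<notin> l \<and> P = {X. dist X F = infdist X l}"

text \<open>The axis of symmetry: the line through the focus \<open>F\<close> perpendicular to the directrix \<open>l\<close>.\<close>

definition parabola_axis :: "point \<Rightarrow> point set \<Rightarrow> point set" where
  "parabola_axis F l = {X. \<forall>Y\<in>l. \<forall>Z\<in>l. (X - F) \<bullet> (Y - Z) = 0}"

definition confocal :: "point set \<Rightarrow> point set \<Rightarrow> bool" where
  "confocal P Q \<longleftrightarrow> (\<exists>F l l'. is_parabola P F l \<and> is_parabola Q F l' \<and>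
     parabola_axis F l = parabola_axis F l')"

text \<open>Tangency of a line to a plane curve, for an arbitrary point set \<open>S\<close>: at some non-isolated
  point \<open>X\<close> of \<open>S\<close> lying on \<open>m\<close>, the distance of \<open>Y \<in> S\<close> to \<open>m\<close> is \<open>o(dist Y X)\<close> as \<open>Y\<close> tends
  to \<open>X\<close>, i.e. the secants \<open>XY\<close> converge to \<open>m\<close>. (Meeting \<open>S\<close> in one point only would not do: lines
  parallel to the axis meet a parabola once without being tangent.)\<close>

definition tangent_to :: "point set \<Rightarrow> point set \<Rightarrow> bool" where
  "tangent_to m S \<longleftrightarrow> is_line m \<and>
     (\<exists>X. X \<in> m \<and> X \<in> S \<and> X islimpt S \<and>
          ((\<lambda>Y. infdist Y m / dist Y X) \<longlongrightarrow> 0) (at X within S))"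

text \<open>Vertices are given in cyclic order and the sides may cross each other. Since
  \<open>collinear {A, B, C}\<close> holds whenever two of the points coincide, the four vertices are
  pairwise distinct.\<close>

definition quadrilateral :: "point \<Rightarrow> point \<Rightarrow> point \<Rightarrow> point \<Rightarrow> bool" where
  "quadrilateral A B C D \<longleftrightarrow>
     \<not> collinear {A, B, C} \<and> \<not> collinear {B, C, D} \<and>
     \<not> collinear {C, D, A} \<and> \<not> collinear {D, A, B}"

definition inscribed :: "point \<Rightarrow> point \<Rightarrow> point \<Rightarrow> point \<Rightarrow> point set \<Rightarrow> bool" where
  "inscribed A B C D K \<longleftrightarrow> A \<in> K \<and> B \<in> K \<and> C \<in> K \<and> D \<in> K"

definition circumscribed :: "point \<Rightarrow> point \<Rightarrow> point \<Rightarrow> point \<Rightarrow> point set \<Rightarrow> bool" where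
  "circumscribed A B C D P \<longleftrightarrow>
     tangent_to (affine hull {A, B}) P \<and> tangent_to (affine hull {B, C}) P \<and>
     tangent_to (affine hull {C, D}) P \<and> tangent_to (affine hull {D, A}) P"

text \<open>The quadrilateral as an unlabelled object, for counting: \<open>ABCD\<close>, its cyclic
  shifts \<open>BCDA\<close>, ... and its reversals have the same sides and so count once.\<close>

definition sides :: "point \<Rightarrow> point \<Rightarrow> point \<Rightarrow> point \<Rightarrow> point set set" where
  "sides A B C D =
     {closed_segment A B, closed_segment B C, closed_segment C D, closed_segment D A}"

definition poncelet_quads :: "point set \<Rightarrow> point set \<Rightarrow> point set set set" where
  "poncelet_quads K P = {sides A B C D | A B C D.
     quadrilateral A B C D \<and> inscribed A B C D K \<and> circumscribed A B C D P}"

end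

theory Submission imports Defs begin

text \<open>
  If \<open>A\<close> and \<open>B\<close> lie on a circle centered at the focus \<open>F\<close>, the reflection of \<open>F\<close> in the line \<open>AB\<close>
  is \<open>A + B - F\<close>, so \<open>AB\<close> is tangent to the parabola iff this point lies on the directrix. In
  coordinates with origin \<open>F\<close> and directrix \<open>x = d\<close> this says that the abscissas of \<open>A\<close> and \<open>B\<close> add up
  to \<open>d\<close>. Hence the vertices \<open>(a, p), (d - a, q), (a, -p), (d - a, -q)\<close> of the circle of radius \<open>r\<close>
  form a circumscribed quadrilateral whenever \<open>d / 2 < a < r\<close>, and \<open>d\<close> may be replaced by any
  number in \<open>(0, 2 r)\<close>.
\<close>

section \<open>Orthonormal coordinates centered at the focus\<close>

locale frame =
  fixes F n :: point
  assumes norm_n: "norm n = 1"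
begin

definition t :: point where "t = vector [- n $ 2, n $ 1]"

definition pt :: "real \<Rightarrow> real \<Rightarrow> point" where "pt x y = F + x *\<^sub>R n + y *\<^sub>R t"

definition directrix :: "real \<Rightarrow> point set" where "directrix d = {X. (X - F) \<bullet> n = d}"

text \<open>The distance to the directrix is written as an absolute value, which
  \<open>infdist_directrix\<close> justifies. With \<open>F\<close> and \<open>n\<close> fixed, the
  nonzero values of \<open>d\<close> give parabolas with common focus and axis.\<close>

definition parabola :: "real \<Rightarrow> point set" where
  "parabola d = {X. dist X F = \<bar>(X - F) \<bullet> n - d\<bar>}"

lemma n_n [simp]: "n \<bullet> n = 1"
  using norm_n by (simp add: dot_square_norm)

lemma n_t [simp]: "n \<bullet> t = 0" and t_n [simp]: "t \<bullet> n = 0"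
  by (simp_all add: t_def inner_vec_def sum_2 algebra_simps)

lemma t_t [simp]: "t \<bullet> t = 1"
  using n_n by (simp add: t_def inner_vec_def sum_2 algebra_simps)

lemma pt_cases: obtains x y where "X = pt x y"
proof
  have sq: "n $ 1 * n $ 1 + n $ 2 * n $ 2 = 1"
    using n_n by (simp add: inner_vec_def sum_2)
  have "v = (v \<bullet> n) *\<^sub>R n + (v \<bullet> t) *\<^sub>R t" for v :: point
    unfolding vec_eq_iff forall_2 t_def inner_vec_def sum_2
    by (simp, intro conjI) (use sq in algebra)+
  from this[of "X - F"] show "X = pt ((X - F) \<bullet> n) ((X - F) \<bullet> t)"
    by (simp add: pt_def algebra_simps)
qed

lemma pt_inner_n [simp]: "(pt x y - F) \<bullet> n = x"
  by (simp add: pt_def inner_simps)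

lemma pt_inner_t: "(pt x y - F) \<bullet> t = y"
  by (simp add: pt_def inner_simps)

lemma pt_eq_iff: "pt x y = pt x' y' \<longleftrightarrow> x = x' \<and> y = y'"
  by (metis pt_inner_n pt_inner_t)

lemma dist_pt: "dist (pt x y) (pt x' y') = sqrt ((x - x')\<^sup>2 + (y - y')\<^sup>2)"
proof -
  have "pt x y - pt x' y' = (x - x') *\<^sub>R n + (y - y') *\<^sub>R t"
    by (simp add: pt_def algebra_simps)
  then show ?thesis
    by (simp add: dist_norm norm_eq_sqrt_inner inner_simps power2_eq_square)
qed

lemma dist_pt_F: "dist (pt x y) F = sqrt (x\<^sup>2 + y\<^sup>2)"
  using dist_pt[of x y 0 0] by (simp add: pt_def)

lemma pt_in_sphere_iff: "0 \<le> r \<Longrightarrow> pt x y \<in> sphere F r \<longleftrightarrow> x\<^sup>2 + y\<^sup>2 = r\<^sup>2"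
  by (auto simp: dist_commute[of F] dist_pt_F real_sqrt_eq_iff intro: real_sqrt_unique)

section \<open>Confocal parabolas in coordinates\<close>

lemma pt_in_parabola_iff: "pt x y \<in> parabola d \<longleftrightarrow> y\<^sup>2 = d\<^sup>2 - 2 * d * x"
proof -
  have "pt x y \<in> parabola d \<longleftrightarrow> sqrt (x\<^sup>2 + y\<^sup>2) = sqrt ((x - d)\<^sup>2)"
    by (simp add: parabola_def dist_pt_F)
  also have "\<dots> \<longleftrightarrow> y\<^sup>2 = d\<^sup>2 - 2 * d * x"
    unfolding real_sqrt_eq_iff by (simp add: power2_eq_square algebra_simps)
  finally show ?thesis .
qed

text \<open>The orthogonal foot \<open>pt d y\<close> attains the value; Cauchy-Schwarz against the
  unit vector \<open>n\<close> shows that no point of the directrix is nearer.\<close>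

lemma infdist_directrix: "infdist X (directrix d) = \<bar>(X - F) \<bullet> n - d\<bar>"
proof -
  obtain x y where X: "X = pt x y" by (rule pt_cases)
  have foot: "pt d y \<in> directrix d" by (simp add: directrix_def)
  have "infdist X (directrix d) \<le> \<bar>x - d\<bar>"
    using infdist_le[OF foot, of X] by (simp add: X dist_pt)
  moreover
  have "\<bar>x - d\<bar> \<le> dist X Z" if "Z \<in> directrix d" for Z
  proof -
    have "(X - Z) \<bullet> n = x - d"
      using that pt_inner_n[of x y] by (simp add: X directrix_def inner_simps)
    then show ?thesis
      using Cauchy_Schwarz_ineq2[of "X - Z" n] by (simp add: norm_n dist_norm)
  qed
  then have "\<bar>x - d\<bar> \<le> infdist X (directrix d)"
    using foot by (subst infdist_notempty) (blast, blast intro: cINF_greatest)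
  ultimately show ?thesis by (simp add: X)
qed

lemma is_parabola_parabola:
  assumes "d \<noteq> 0"
  shows "is_parabola (parabola d) F (directrix d)"
proof -
  have n0: "n \<noteq> 0" using norm_n by auto
  have dir: "directrix d = {X. n \<bullet> X = d + n \<bullet> F}"
    by (auto simp: directrix_def inner_simps inner_commute)
  have "is_line (directrix d)"
    unfolding is_line_def dir using n0 by (simp add: affine_hyperplane)
  moreover have "F \<notin> directrix d" using assms by (simp add: directrix_def)
  ultimately show ?thesis
    by (simp add: is_parabola_def parabola_def infdist_directrix)
qed

text \<open>Differences of points of the directrix are multiples of \<open>t\<close>. The right-hand
  side is free of \<open>d\<close>, which is what makes these parabolas confocal.\<close>

lemma parabola_axis_directrix: "parabola_axis F (directrix d) = {X. (X - F) \<bullet> t = 0}"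
proof (intro equalityI subsetI)
  fix X assume "X \<in> parabola_axis F (directrix d)"
  moreover have "pt d 1 \<in> directrix d" "pt d 0 \<in> directrix d"
    by (simp_all add: directrix_def)
  ultimately have "(X - F) \<bullet> (pt d 1 - pt d 0) = 0"
    by (auto simp: parabola_axis_def)
  then show "X \<in> {X. (X - F) \<bullet> t = 0}" by (simp add: pt_def)
next
  fix X assume X: "X \<in> {X. (X - F) \<bullet> t = 0}"
  have "(X - F) \<bullet> (Y - Z) = 0" if "Y \<in> directrix d" "Z \<in> directrix d" for Y Z
  proof -
    obtain x y where Y: "Y = pt x y" by (rule pt_cases)
    obtain x' y' where Z: "Z = pt x' y'" by (rule pt_cases)
    from Y Z have "Y - Z = (y - y') *\<^sub>R t"
      using that by (simp add: directrix_def) (simp add: pt_def algebra_simps)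
    then show ?thesis using X by simp
  qed
  then show "X \<in> parabola_axis F (directrix d)" by (simp add: parabola_axis_def)
qed

lemma confocal_parabola:
  assumes "d \<noteq> 0" "d' \<noteq> 0"
  shows "confocal (parabola d) (parabola d')"
  unfolding confocal_def
proof (intro exI conjI)
  show "is_parabola (parabola d) F (directrix d)" "is_parabola (parabola d') F (directrix d')"
    using assms by (auto intro: is_parabola_parabola)
  show "parabola_axis F (directrix d) = parabola_axis F (directrix d')"
    by (simp only: parabola_axis_directrix)
qed

lemma parabola_eq_iff:
  assumes "d \<noteq> 0" "d' \<noteq> 0"
  shows "parabola d = parabola d' \<longleftrightarrow> d = d'"
proof
  assume "parabola d = parabola d'"
  \<comment> \<open>This point is the vertex; on \<open>parabola d'\<close> the equation becomes
    \<open>d' * (d' - d) = 0\<close>.\<close>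
  moreover have "pt (d / 2) 0 \<in> parabola d"
    by (simp add: pt_in_parabola_iff power2_eq_square)
  ultimately have "pt (d / 2) 0 \<in> parabola d'" by simp
  then show "d = d'" using assms by (simp add: pt_in_parabola_iff power2_eq_square)
qed simp

section \<open>Tangent lines\<close>

lemma islimpt_parabola:
  assumes "d \<noteq> 0" "X \<in> parabola d"
  shows "X islimpt parabola d"
proof -
  obtain x g where X: "X = pt x g" by (rule pt_cases)
  \<comment> \<open>The ordinate parametrizes the parabola continuously and injectively, so
    \<open>y\<close> tending to \<open>g\<close> yields points other than \<open>X\<close>
    converging to \<open>X\<close>.\<close>
  define c where "c y = pt ((d\<^sup>2 - y\<^sup>2) / (2 * d)) y" for y
  have "X = c g"
    using assms by (simp add: X c_def pt_eq_iff pt_in_parabola_iff)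
  moreover have "c y \<in> parabola d" for y
    using assms by (simp add: c_def pt_in_parabola_iff)
  moreover have "(c \<longlongrightarrow> c g) (at g)"
    unfolding c_def pt_def using assms by (auto intro!: tendsto_eq_intros)
  moreover have "\<forall>\<^sub>F y in at g. c y \<noteq> c g"
    by (simp add: c_def pt_eq_iff eventually_at_filter)
  ultimately have "(c \<longlongrightarrow> X) (at g)" "\<forall>\<^sub>F y in at g. c y \<in> parabola d - {X}"
    by auto
  then have "\<forall>\<^sub>F y in at g. c y \<in> parabola d - {X} \<and> dist (c y) X < e" if "e > 0" for e
    using that by (intro eventually_conj tendstoD)
  from eventually_happens'[OF trivial_limit_at this] show ?thesis
    unfolding islimpt_approachable by blast
qed

text \<open>On the parabola, the distance to the chord line is bounded by a multiple of the squared
  distance to the point of contact, hence is of smaller order.\<close>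

lemma chord_tangent:
  assumes "d > 0" and ab: "a + b = d"
    and A: "a\<^sup>2 + p\<^sup>2 = r\<^sup>2" and B: "b\<^sup>2 + q\<^sup>2 = r\<^sup>2"
    and neq: "pt a p \<noteq> pt b q"
  shows "tangent_to (affine hull {pt a p, pt b q}) (parabola d)"
proof -
  define m where "m = affine hull {pt a p, pt b q}"
  define g where "g = p + q"
  define w where "w = d *\<^sub>R n + g *\<^sub>R t"
  \<comment> \<open>\<open>H\<close> is the perpendicular bisector of \<open>F\<close> and
    \<open>F + w\<close>, the latter being \<open>pt d g\<close>.\<close>
  define H where "H = {Y. w \<bullet> Y = w \<bullet> F + (d\<^sup>2 + g\<^sup>2) / 2}"
  have wn: "w \<bullet> n = d" by (simp add: w_def inner_simps)
  then have w0: "w \<noteq> 0" using \<open>d > 0\<close> by auto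
  have H_iff: "pt x y \<in> H \<longleftrightarrow> d * x + g * y = (d\<^sup>2 + g\<^sup>2) / 2" for x y
    by (simp add: H_def pt_def w_def inner_simps algebra_simps)
  have dim: "aff_dim m = 1"
    using neq by (simp add: m_def aff_dim_2)
  \<comment> \<open>By \<open>a + b = d\<close> and the circle equations, both sides of
    \<open>H_iff\<close> equal \<open>r\<^sup>2 + a * b + p * q\<close> at either endpoint.\<close>
  have "pt a p \<in> H" "pt b q \<in> H"
    unfolding H_iff g_def ab[symmetric] using A B
    by (simp_all add: power2_eq_square field_simps)
  moreover have "affine H" by (simp add: H_def affine_hyperplane)
  ultimately have "m \<subseteq> H"
    unfolding m_def by (intro hull_minimal) auto
  moreover have "aff_dim H = 1" using w0 by (simp add: H_def)
  ultimately have mH: "m = H"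
    using dim \<open>affine H\<close> by (intro affine_dim_equal) (auto simp: m_def)
  \<comment> \<open>\<open>(d, g)\<close> is the reflection of the focus; the point of contact lies on the perpendicular to
    the directrix there.\<close>
  define X where "X = pt ((d\<^sup>2 - g\<^sup>2) / (2 * d)) g"
  have XS: "X \<in> parabola d"
    using \<open>d > 0\<close> by (simp add: X_def pt_in_parabola_iff)
  have Xm: "X \<in> m"
    using \<open>d > 0\<close> by (simp add: mH X_def H_iff power2_eq_square field_simps)
  have bound: "infdist Y m / dist Y X \<le> dist Y X / (2 * d)" if Y: "Y \<in> parabola d" for Y
  proof -
    obtain x y where Yxy: "Y = pt x y" by (rule pt_cases)
    have y: "y\<^sup>2 = d\<^sup>2 - 2 * d * x" using Y by (simp add: Yxy pt_in_parabola_iff)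
    define s where "s = d\<^sup>2 + g\<^sup>2"
    have s: "s > 0" using \<open>d > 0\<close> by (simp add: s_def add_pos_nonneg)
    \<comment> \<open>\<open>k *\<^sub>R w\<close> leads from \<open>Y\<close> to its orthogonal
      foot on \<open>m\<close>: the equation of the parabola turns
      \<open>s / 2 - (d * x + g * y)\<close> into \<open>(y - g)\<^sup>2 / 2\<close>.\<close>
    define k where "k = (y - g)\<^sup>2 / (2 * s)"
    have ks: "k * s = (y - g)\<^sup>2 / 2" using s by (simp add: k_def)
    have "d * (x + k * d) + g * (y + k * g) = d * x + g * y + k * s"
      by (simp add: s_def power2_eq_square algebra_simps)
    also have "\<dots> = s / 2"
      unfolding ks using y by (simp add: s_def power2_eq_square field_simps)
    finally have Z: "pt (x + k * d) (y + k * g) \<in> m"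
      by (simp add: mH H_iff s_def)
    have "(k * d)\<^sup>2 + (k * g)\<^sup>2 = k\<^sup>2 * s"
      by (simp add: s_def power_mult_distrib algebra_simps)
    then have "dist Y (pt (x + k * d) (y + k * g)) = k * sqrt s"
      using s by (simp add: Yxy dist_pt real_sqrt_mult k_def)
    with infdist_le[OF Z, of Y] have "infdist Y m \<le> k * sqrt s" by simp
    also have "\<dots> = (y - g)\<^sup>2 / (2 * sqrt s)"
      using s real_sqrt_mult_self[of s] by (simp add: k_def field_simps)
    also have "\<dots> \<le> (y - g)\<^sup>2 / (2 * d)"
    proof -
      have "d \<le> sqrt s" by (simp add: s_def)
      then show ?thesis using \<open>d > 0\<close> s by (intro divide_left_mono) auto
    qed
    also have "\<dots> \<le> (dist Y X)\<^sup>2 / (2 * d)"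
      using \<open>d > 0\<close> by (intro divide_right_mono) (auto simp: Yxy X_def dist_pt)
    finally have "infdist Y m / dist Y X \<le> (dist Y X)\<^sup>2 / (2 * d) / dist Y X"
      by (intro divide_right_mono) auto
    \<comment> \<open>\<open>u = 0\<close> is the case \<open>Y = X\<close>, where division by zero
      makes both sides 0.\<close>
    moreover have "u\<^sup>2 / (2 * d) / u = u / (2 * d)" for u :: real
      by (cases "u = 0") (simp_all add: power2_eq_square)
    ultimately show ?thesis by (simp only:)
  qed
  have "((\<lambda>Y. dist Y X / (2 * d)) \<longlongrightarrow> dist X X / (2 * d)) (at X within parabola d)"
    using \<open>d > 0\<close> by (intro tendsto_intros) auto
  then have lim: "((\<lambda>Y. dist Y X / (2 * d)) \<longlongrightarrow> 0) (at X within parabola d)" by simp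
  have "((\<lambda>Y. infdist Y m / dist Y X) \<longlongrightarrow> 0) (at X within parabola d)"
  proof (rule tendsto_sandwich[OF _ _ tendsto_const lim])
    show "\<forall>\<^sub>F Y in at X within parabola d. 0 \<le> infdist Y m / dist Y X"
      by (intro always_eventually allI divide_nonneg_nonneg infdist_nonneg zero_le_dist)
    show "\<forall>\<^sub>F Y in at X within parabola d. infdist Y m / dist Y X \<le> dist Y X / (2 * d)"
      unfolding eventually_at_filter by (intro always_eventually allI impI bound)
  qed
  moreover have "is_line m" using dim by (simp add: is_line_def m_def)
  moreover have "X islimpt parabola d"
    using XS \<open>d > 0\<close> by (intro islimpt_parabola) auto
  ultimately show ?thesis
    unfolding tangent_to_def m_def[symmetric] using XS Xm by blast
qed

section \<open>The quadrilaterals and their number\<close>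

lemma collinear_pt:
  assumes "collinear {pt x y, pt x' y', pt x'' y''}"
  shows "(x' - x) * (y'' - y) = (x'' - x) * (y' - y)"
proof -
  obtain u where "\<forall>X\<in>{pt x y, pt x' y', pt x'' y''}. \<forall>Y\<in>{pt x y, pt x' y', pt x'' y''}.
      \<exists>c. X - Y = c *\<^sub>R u"
    using assms unfolding collinear_def by blast
  then obtain c c' where c: "pt x' y' - pt x y = c *\<^sub>R u" "pt x'' y'' - pt x y = c' *\<^sub>R u"
    by (meson insertI1 insertI2)
  have "x' - x = c * (u \<bullet> n)" "x'' - x = c' * (u \<bullet> n)"
    "y' - y = c * (u \<bullet> t)" "y'' - y = c' * (u \<bullet> t)"
    using arg_cong[OF c(1), of "\<lambda>v. v \<bullet> n"] arg_cong[OF c(2), of "\<lambda>v. v \<bullet> n"]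
      arg_cong[OF c(1), of "\<lambda>v. v \<bullet> t"] arg_cong[OF c(2), of "\<lambda>v. v \<bullet> t"]
    by (simp_all add: pt_def inner_simps)
  then show ?thesis by simp
qed

text \<open>Abscissas alternate between \<open>a\<close> and \<open>d - a\<close>, so
  \<open>chord_tangent\<close> applies to all four sides. The last three conclusions single out
  \<open>a\<close> as the largest abscissa on the sides, for counting.\<close>

lemma poncelet_quad:
  assumes "0 < d" "d < 2 * r" "d / 2 < a" "a < r"
  obtains A B C D where "quadrilateral A B C D" "inscribed A B C D (sphere F r)"
    "circumscribed A B C D (parabola d)" "A \<in> \<Union>(sides A B C D)" "(A - F) \<bullet> n = a"
    "\<Union>(sides A B C D) \<subseteq> {X. (X - F) \<bullet> n \<le> a}"
proof -
  define b where "b = d - a"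
  define p where "p = sqrt (r\<^sup>2 - a\<^sup>2)"
  define q where "q = sqrt (r\<^sup>2 - b\<^sup>2)"
  \<comment> \<open>The bounds amount to \<open>0 < d / 2 < a < r\<close> and
    \<open>- r < d - r < b < a\<close>.\<close>
  have "\<bar>a\<bar> < r" "\<bar>b\<bar> < r" and ba: "b < a" and ab: "a + b = d" using assms by (auto simp: b_def)
  then have less: "a\<^sup>2 < r\<^sup>2" "b\<^sup>2 < r\<^sup>2"
    by (simp_all add: power2_strict_mono abs_less_iff)
  then have pq: "p > 0" "q > 0" by (simp_all add: p_def q_def)
  have A: "a\<^sup>2 + p\<^sup>2 = r\<^sup>2" and B: "b\<^sup>2 + q\<^sup>2 = r\<^sup>2" using less by (simp_all add: p_def q_def)
  show thesis
  proof
    let ?A = "pt a p" and ?B = "pt b q" and ?C = "pt a (- p)" and ?D = "pt b (- q)"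
    \<comment> \<open>Any three vertices include two mirror images in the axis, distinct as
      \<open>p\<close> and \<open>q\<close> are positive, and a third vertex with the other
      abscissa.\<close>
    show "quadrilateral ?A ?B ?C ?D"
      unfolding quadrilateral_def using ba pq by (auto dest!: collinear_pt)
    show "inscribed ?A ?B ?C ?D (sphere F r)"
      using A B assms by (simp add: inscribed_def pt_in_sphere_iff del: mem_sphere)
    show "circumscribed ?A ?B ?C ?D (parabola d)"
      unfolding circumscribed_def using A B ab ba \<open>0 < d\<close>
      by (intro conjI chord_tangent[where r = r]) (auto simp: pt_eq_iff)
    show "?A \<in> \<Union>(sides ?A ?B ?C ?D)" by (simp add: sides_def)
    show "(?A - F) \<bullet> n = a" by simp
    \<comment> \<open>This half-plane is convex and contains the vertices because
      \<open>b < a\<close>, so it contains the sides.\<close>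
    have "{X. (X - F) \<bullet> n \<le> a} = {X. n \<bullet> X \<le> a + n \<bullet> F}"
      by (auto simp: inner_simps inner_commute)
    then have "convex {X. (X - F) \<bullet> n \<le> a}"
      by (simp add: convex_halfspace_le)
    then show "\<Union>(sides ?A ?B ?C ?D) \<subseteq> {X. (X - F) \<bullet> n \<le> a}"
      unfolding sides_def using ba by (auto dest!: closed_segment_subset[rotated 2] subsetD)
  qed
qed

lemma infinite_poncelet_quads:
  assumes "0 < d" "d < 2 * r"
  shows "infinite (poncelet_quads (sphere F r) (parabola d))"
proof
  \<comment> \<open>The abscissa of \<open>A\<close> is recovered from the set of sides as the largest abscissa on it.\<close>
  define top where
    "top S a \<longleftrightarrow> (\<exists>X\<in>\<Union>S. (X - F) \<bullet> n = a) \<and> \<Union>S \<subseteq> {X. (X - F) \<bullet> n \<le> a}" for S a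
  assume "finite (poncelet_quads (sphere F r) (parabola d))"
  \<comment> \<open>A finite set of quadrilaterals would map onto a whole interval.\<close>
  moreover have "{d / 2<..<r} \<subseteq> (\<lambda>S. THE a. top S a) ` poncelet_quads (sphere F r) (parabola d)"
  proof
    fix a assume "a \<in> {d / 2<..<r}"
    then have "d / 2 < a" "a < r" by auto
    then obtain A B C D where q: "quadrilateral A B C D" "inscribed A B C D (sphere F r)"
        "circumscribed A B C D (parabola d)"
      and "A \<in> \<Union>(sides A B C D)" "(A - F) \<bullet> n = a"
        "\<Union>(sides A B C D) \<subseteq> {X. (X - F) \<bullet> n \<le> a}"
      by (rule poncelet_quad[OF assms])
    then have "top (sides A B C D) a" unfolding top_def by blast
    \<comment> \<open>Two such values are both attained and bound each other, hence agree.\<close>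
    then have "(THE a. top (sides A B C D) a) = a"
      by (intro the_equality) (auto simp: top_def intro: antisym)
    with q show "a \<in> (\<lambda>S. THE a. top S a) ` poncelet_quads (sphere F r) (parabola d)"
      unfolding poncelet_quads_def by blast
  qed
  ultimately have "finite {d / 2<..<r}" by (meson finite_surj)
  then show False using assms by (simp add: infinite_Ioo)
qed

end

section \<open>The frame of an arbitrary parabola, and the conclusion\<close>

lemma is_parabola_frame:
  assumes "is_parabola P F l"
  obtains n where "frame n" "P = frame.parabola F n (infdist F l)" "infdist F l > 0"
proof -
  from assms have l: "affine l" "aff_dim l = 1" "F \<notin> l"
    and P: "P = {X. dist X F = infdist X l}"
    by (auto simp: is_parabola_def is_line_def)
  from l obtain a b where "a \<noteq> 0" and hyp: "l = {x. a \<bullet> x = b}"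
    using aff_dim_eq_hyperplane[of l] by (auto simp: hull_same)
  \<comment> \<open>\<open>e / norm a\<close> is the signed distance from \<open>F\<close> to
    \<open>l\<close> along \<open>a\<close>.\<close>
  define e where "e = b - a \<bullet> F"
  have e: "e \<noteq> 0" using l hyp by (auto simp: e_def)
  \<comment> \<open>The sign turns the unit normal towards the directrix, which makes the abscissa
    of the directrix positive.\<close>
  define n where "n = (sgn e / norm a) *\<^sub>R a"
  interpret frame F n
    using \<open>a \<noteq> 0\<close> e by unfold_locales (simp add: n_def norm_sgn abs_sgn_eq)
  have "(X - F) \<bullet> n = \<bar>e\<bar> / norm a \<longleftrightarrow> a \<bullet> X = b" for X
  proof -
    have "(X - F) \<bullet> n = sgn e / norm a * (a \<bullet> X - a \<bullet> F)"
      by (simp add: n_def inner_simps inner_commute)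
    moreover have "\<bar>e\<bar> / norm a = sgn e / norm a * e" by (simp add: abs_sgn)
    moreover have "sgn e / norm a \<noteq> 0" using \<open>a \<noteq> 0\<close> e by (simp add: sgn_zero_iff)
    ultimately have "(X - F) \<bullet> n = \<bar>e\<bar> / norm a \<longleftrightarrow> a \<bullet> X - a \<bullet> F = e"
      by (metis mult_left_cancel)
    then show ?thesis by (auto simp: e_def)
  qed
  then have dir: "l = directrix (\<bar>e\<bar> / norm a)" by (auto simp: hyp directrix_def)
  have d: "infdist F l = \<bar>e\<bar> / norm a" by (simp add: dir infdist_directrix)
  show thesis
  proof
    show "frame n" by (rule frame_axioms)
    show "P = parabola (infdist F l)"
      unfolding d by (simp add: P dir infdist_directrix parabola_def)
    show "infdist F l > 0" using d e \<open>a \<noteq> 0\<close> by simp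
  qed
qed

theorem theorem4p2:
  fixes P l :: "point set" and F :: point and r :: real
  assumes "is_parabola P F l"
    and "2 * r > infdist F l"
  shows "(\<exists>A B C D. quadrilateral A B C D \<and> inscribed A B C D (sphere F r) \<and>
            circumscribed A B C D P)
    \<and> infinite (poncelet_quads (sphere F r) P)
    \<and> infinite {Q. confocal P Q \<and>
         (\<exists>A B C D. quadrilateral A B C D \<and> inscribed A B C D (sphere F r) \<and>
            circumscribed A B C D Q) \<and>
         infinite (poncelet_quads (sphere F r) Q)}"
proof -
  define d where "d = infdist F l"
  obtain n where "frame n" and P: "P = frame.parabola F n d" and "d > 0"
    using is_parabola_frame[OF assms(1)] unfolding d_def by blast
  then interpret frame F n by simp
  have dr: "d < 2 * r" using assms(2) by (simp add: d_def)
  have ex: "\<exists>A B C D. quadrilateral A B C D \<and> inscribed A B C D (sphere F r) \<and>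
      circumscribed A B C D (parabola d')" if "0 < d'" "d' < 2 * r" for d'
  proof -
    obtain a where "d' / 2 < a" "a < r" using dense[of "d' / 2" r] \<open>d' < 2 * r\<close> by auto
    with that obtain A B C D where "quadrilateral A B C D" "inscribed A B C D (sphere F r)"
        "circumscribed A B C D (parabola d')"
      by (rule poncelet_quad)
    then show ?thesis by blast
  qed
  let ?Q = "{Q. confocal P Q \<and>
         (\<exists>A B C D. quadrilateral A B C D \<and> inscribed A B C D (sphere F r) \<and>
            circumscribed A B C D Q) \<and>
         infinite (poncelet_quads (sphere F r) Q)}"
  \<comment> \<open>Within the frame of \<open>P\<close>, the directrix moves over all abscissas
    between 0 and \<open>2 * r\<close>: focus and axis stay, and the circle still admits its
    quadrilaterals.\<close>
  have "parabola ` {0<..<2 * r} \<subseteq> ?Q"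
    using \<open>d > 0\<close> ex infinite_poncelet_quads by (auto simp: P confocal_parabola)
  moreover have "inj_on parabola {0<..<2 * r}"
    by (auto simp: inj_on_def parabola_eq_iff)
  moreover have "infinite {0<..<2 * r}" using \<open>d > 0\<close> dr by (simp add: infinite_Ioo)
  ultimately have "infinite ?Q" by (meson finite_imageD finite_subset)
  with ex[of d] infinite_poncelet_quads[of d r] \<open>d > 0\<close> dr show ?thesis
    unfolding P by blast
qed

end
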